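(* Let $0\le m\le N$ be integers, let $q,c$ be nonzero complex numbers, and let $g_m(x)$ be a function such that $$\frac{g_m(x)}{(cx,c/x;q,p)_m}\in W_c^N.$$ Then there exists a sequence of complex numbers $\{\lambda_k\}_{k=0}^{N}$, independent of $x$, such that $$g_m(x)=\frac{1}{x^m}\bigg(\sum_{k=0}^N\lambda_k P(x)^kQ(x)^{N-k}\bigg)\prod_{k=0}^{N-m-1}\frac{1}{P(cq^{m+k})Q(x)-Q(cq^{m+k})P(x)}.$$ In particular, when $m=N$, $$g_N(x)=\frac{1}{x^N}\sum_{k=0}^N\lambda_k P(x)^kQ(x)^{N-k}.$$
   Context: Let $p\in\mathbb{C}$, $0<|p|<1$. Write $(x;p)_\infty=\prod_{n=0}^\infty(1-xp^n)$. The modified Jacobi theta function is $\theta(x;p)=\prod_{n=0}^{\infty}(1-xp^n)(1-p^{n+1}/x)$ for $x\ne 0$. The theta $q,p$-shifted factorial is $(x;q,p)_n=\prod_{k=0}^{n-1}\theta(xq^k;p)$, and $(x_1,\dots,x_r;q,p)_n=\prod_{k=1}^r(x_k;q,p)_n$. Empty products equal $1$. Define, for $x\ne 0$, $P(x)=\theta(-x^2;p^2)\,(-p;p)_\infty$ and $Q(x)=x\,\theta(-px^2;p^2)\,(-p;p)_\infty$. For an integer $N\ge0$ and $c\ne0$, $W_c^N$ is the complex linear space spanned by all functions of the form $\dfrac{g_k(x)}{(cx,c/x;q,p)_k}$, $0\le k\le N$, where $g_k$ runs over all functions holomorphic on $x\neq0$ satisfying $g_k(x)=g_k(1/x)$ and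 $g_k(px)=\dfrac{1}{p^kx^{2k}}g_k(x)$. Equalities are between (meromorphic) functions of $x\in\mathbb{C}\setminus\{0\}$. *)

theory Defs
  imports "HOL-Complex_Analysis.Complex_Analysis" "HOL-Library.Function_Algebras"
begin

definition qPoch_inf :: "complex \<Rightarrow> complex \<Rightarrow> complex" where
  "qPoch_inf x p = (\<Prod>n. 1 - x * p ^ n)"

definition mtheta :: "complex \<Rightarrow> complex \<Rightarrow> complex" where
  "mtheta x p = (\<Prod>n. (1 - x * p ^ n) * (1 - p ^ (n + 1) / x))"

definition theta_fact :: "complex \<Rightarrow> complex \<Rightarrow> complex \<Rightarrow> nat \<Rightarrow> complex" where
  "theta_fact x q p n = (\<Prod>k<n. mtheta (x * q ^ k) p)"

definition theta_facts :: "complex list \<Rightarrow> complex \<Rightarrow> complex \<Rightarrow> nat \<Rightarrow> complex" where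
  "theta_facts xs q p n = (\<Prod>x\<leftarrow>xs. theta_fact x q p n)"

definition Pfun :: "complex \<Rightarrow> complex \<Rightarrow> complex" where
  "Pfun p x = mtheta (- (x ^ 2)) (p ^ 2) * qPoch_inf (- p) p"

definition Qfun :: "complex \<Rightarrow> complex \<Rightarrow> complex" where
  "Qfun p x = x * mtheta (- p * x ^ 2) (p ^ 2) * qPoch_inf (- p) p"

definition numerators :: "complex \<Rightarrow> nat \<Rightarrow> (complex \<Rightarrow> complex) set" where
  "numerators p k = {g. g holomorphic_on - {0} \<and>
     (\<forall>x. x \<noteq> 0 \<longrightarrow> g x = g (1 / x)) \<and>
     (\<forall>x. x \<noteq> 0 \<longrightarrow> g (p * x) = 1 / (p ^ k * x ^ (2 * k)) * g x)}"

global_interpretation cfun: vector_space "\<lambda>(a::complex) (f::complex \<Rightarrow> complex) x. a * f x"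
  by unfold_locales (auto simp: fun_eq_iff algebra_simps)

(* The elements of the space are meromorphic functions on the punctured plane. These are
   represented by total functions, two of which are the same meromorphic function iff they
   agree off a subset of the punctured plane without limit point in it; in particular the
   values at 0 and at poles are irrelevant. The space is closed under this equality. *)
definition Wspace :: "complex \<Rightarrow> complex \<Rightarrow> complex \<Rightarrow> nat \<Rightarrow> (complex \<Rightarrow> complex) set" where
  "Wspace p q c N =
     {f. \<exists>h \<in> cfun.span {\<lambda>x. g x / theta_facts [c * x, c / x] q p k |g k.
              k \<le> N \<and> g \<in> numerators p k}.
         \<forall>\<^sub>\<approx>x\<in>- {0}. f x = h x}"

end

theory Submission
  imports Defs
begin

text \<open>
  The point is that $W_c^N$ becomes a space of binary forms once denominators are cleared.
  The functions $P(x)/x$ and $Q(x)/x$ are invariant under $x \mapsto 1/x$ and are multiplied by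
  $1/(p x^2)$ under $x \mapsto p x$, so the admissible numerators of index $n$ include
  $x^{-n} \sum_k \lambda_k P(x)^k Q(x)^{n-k}$. Two facts carry the proof.

  The first is that there are no other numerators of index $n$ (\<open>numerators_subset_forms\<close>).
  All zeros of $P$ are simple and lie in the orbit of $i$ under $x \mapsto 1/x$ and
  $x \mapsto p x$. Since $Q(i) \neq 0$, a multiple of $(Q(x)/x)^n$ can be subtracted from a
  numerator $g$ of index $n$ so that the difference vanishes at $i$, hence on the whole orbit,
  hence at every zero of $P$. Dividing by $P(x)/x$ leaves a numerator of index $n - 1$, and
  induction applies. Index $0$ is Liouville's theorem: a holomorphic function on the punctured
  plane with $g(px) = g(x)$ is determined by its values on a compact annulus, so it is bounded
  and therefore constant.

  The second is the addition formula
  $P(a) Q(x) - Q(a) P(x) = C\, x\, \theta(ax;p)\, \theta(a/x;p)$ with a constant $C \neq 0$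
  depending on $p$ only (\<open>theta_addition\<close>). For fixed $a$ the product of thetas is a
  numerator of index $1$, so by the first fact $x$ times it is a linear combination of $P(x)$ and
  $Q(x)$; the coefficients are read off at a zero of $P$ and at a zero of $Q$.

  By the addition formula with $a = c q^j$, multiplying the $k$-th kind of generator of $W_c^N$ by
  $\prod_{j<N} (P(c q^j) Q(x) - Q(c q^j) P(x))$ cancels its denominator, turns its numerator
  into a form of degree $k$, and contributes $N - k$ further linear forms. The result is a form
  of degree $N$, and so is the result for any linear combination of generators. For
  $g_m(x)/(cx,c/x;q,p)_m$ the same product cancels the denominator and leaves, up to a
  constant, $g_m(x) x^m$ times the linear factors with $j \geq m$, which is the formula claimed. All divisions are legitimate
  off the zeros of the theta factors, which have no limit point in the punctured plane.
\<close>

section \<open>Infinite products and the theta function\<close>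

lemma convergent_qPoch_inf:
  fixes x p :: complex
  assumes "norm p < 1"
  shows "convergent_prod (\<lambda>n. 1 - x * p ^ n)"
proof -
  have "summable (\<lambda>n. norm x * norm p ^ n)"
    using assms by (intro summable_mult summable_geometric) auto
  hence "abs_convergent_prod (\<lambda>n. 1 - x * p ^ n)"
    by (simp add: abs_convergent_prod_conv_summable norm_mult norm_power)
  thus ?thesis by (rule abs_convergent_prod_imp_convergent_prod)
qed

lemma qPoch_inf_step:
  assumes "norm p < 1"
  shows "qPoch_inf x p = (1 - x) * qPoch_inf (p * x) p"
proof -
  have "(\<lambda>n. \<Prod>i\<le>n. 1 - (p * x) * p ^ i) \<longlonglongrightarrow> qPoch_inf (p * x) p"
    unfolding qPoch_inf_def by (intro convergent_prod_LIMSEQ convergent_qPoch_inf assms)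
  hence "(\<lambda>n. (1 - x) * (\<Prod>i\<le>n. 1 - (p * x) * p ^ i)) \<longlonglongrightarrow> (1 - x) * qPoch_inf (p * x) p"
    by (intro tendsto_intros)
  moreover have "(1 - x) * (\<Prod>i\<le>n. 1 - (p * x) * p ^ i) = (\<Prod>i\<le>Suc n. 1 - x * p ^ i)" for n
    by (subst prod.atMost_Suc_shift) (simp add: mult_ac)
  ultimately have "(\<lambda>n. \<Prod>i\<le>Suc n. 1 - x * p ^ i) \<longlonglongrightarrow> (1 - x) * qPoch_inf (p * x) p"
    by simp
  moreover have "(\<lambda>n. \<Prod>i\<le>n. 1 - x * p ^ i) \<longlonglongrightarrow> qPoch_inf x p"
    unfolding qPoch_inf_def by (intro convergent_prod_LIMSEQ convergent_qPoch_inf assms)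
  hence "(\<lambda>n. \<Prod>i\<le>Suc n. 1 - x * p ^ i) \<longlonglongrightarrow> qPoch_inf x p"
    by (rule LIMSEQ_Suc)
  ultimately show ?thesis using LIMSEQ_unique by blast
qed

lemma qPoch_inf_eq_0D:
  assumes "norm p < 1" "qPoch_inf x p = 0"
  obtains n where "x * p ^ n = 1"
  using prodinf_nonzero[OF convergent_qPoch_inf[OF assms(1), of x]] assms(2)
  unfolding qPoch_inf_def by auto

lemma qPoch_inf_nonzero:
  assumes "norm p < 1" "norm x < 1"
  shows "qPoch_inf x p \<noteq> 0"
proof
  assume "qPoch_inf x p = 0"
  then obtain n where n: "x * p ^ n = 1"
    using qPoch_inf_eq_0D[OF assms(1)] by blast
  have "norm (x * p ^ n) \<le> norm x * 1"
    unfolding norm_mult norm_power using assms by (intro mult_left_mono power_le_one) auto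
  with n assms show False by simp
qed

text \<open>
  The factors pair up by $(1 - x p^n)(1 + x p^n) = 1 - x^2 p^{2n}$. This relates the thetas to the
  base $p$ in the denominators with those to the base $p^2$ in $P$ and $Q$.
\<close>

lemma qPoch_inf_mult_minus:
  assumes "norm p < 1"
  shows "qPoch_inf x p * qPoch_inf (- x) p = qPoch_inf (x\<^sup>2) (p\<^sup>2)"
  unfolding qPoch_inf_def
proof (subst prodinf_mult)
  show "(\<Prod>n. (1 - x * p ^ n) * (1 - - x * p ^ n)) = (\<Prod>n. 1 - x\<^sup>2 * (p\<^sup>2) ^ n)"
    by (rule prodinf_cong) (simp add: algebra_simps power2_eq_square power_mult_distrib)
qed (use convergent_qPoch_inf[OF assms, of x] convergent_qPoch_inf[OF assms, of "- x"] in auto)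

text \<open>
  The partial products converge uniformly on closed discs of radius $1$, by comparison with a
  geometric series.
\<close>

lemma qPoch_inf_holomorphic:
  assumes "norm p < 1"
  shows "(\<lambda>x. qPoch_inf x p) holomorphic_on UNIV"
proof (rule holomorphic_uniform_sequence)
  show "(\<lambda>x. \<Prod>i<n. 1 - x * p ^ i) holomorphic_on UNIV" for n
    by (intro holomorphic_intros)
next
  fix z :: complex
  have "uniformly_convergent_on (cball z 1) (\<lambda>N x. \<Sum>n<N. norm (1 - x * p ^ n - 1))"
  proof (rule Weierstrass_m_test'_ev)
    show "\<forall>\<^sub>F n in sequentially. \<forall>x\<in>cball z 1. norm (norm (1 - x * p ^ n - 1)) \<le> (norm z + 1) * norm p ^ n"
    proof (intro always_eventually allI ballI)
      fix n x assume "x \<in> cball z 1"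
      hence "norm (z - x) \<le> 1" by (simp add: dist_norm)
      hence "norm x \<le> norm z + 1" by norm
      thus "norm (norm (1 - x * p ^ n - 1)) \<le> (norm z + 1) * norm p ^ n"
        by (auto simp: norm_mult norm_power intro!: mult_right_mono)
    qed
    show "summable (\<lambda>n. (norm z + 1) * norm p ^ n)"
      using assms by (intro summable_mult summable_geometric) auto
  qed
  hence uc: "uniformly_convergent_on (cball z 1) (\<lambda>N x. \<Prod>n<N. 1 - x * p ^ n)"
    by (intro uniformly_convergent_on_prod' continuous_intros compact_cball)
  have "uniform_limit (cball z 1) (\<lambda>N x. \<Prod>n<N. 1 - x * p ^ n) (\<lambda>x. qPoch_inf x p) sequentially"
  proof -
    obtain l where l: "uniform_limit (cball z 1) (\<lambda>N x. \<Prod>n<N. 1 - x * p ^ n) l sequentially"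
      using uc unfolding uniformly_convergent_on_def by blast
    have "l x = qPoch_inf x p" if "x \<in> cball z 1" for x
    proof -
      have "(\<lambda>n. \<Prod>i<n. 1 - x * p ^ i) \<longlonglongrightarrow> qPoch_inf x p"
        using convergent_prod_LIMSEQ[OF convergent_qPoch_inf[OF assms, of x]]
        unfolding qPoch_inf_def by (simp add: LIMSEQ_lessThan_iff_atMost)
      moreover have "(\<lambda>n. \<Prod>i<n. 1 - x * p ^ i) \<longlonglongrightarrow> l x"
        using tendsto_uniform_limitI[OF l that] .
      ultimately show ?thesis using LIMSEQ_unique by blast
    qed
    thus ?thesis using l uniform_limit_cong' by (metis (no_types, lifting))
  qed
  thus "\<exists>d. 0 < d \<and> cball z d \<subseteq> UNIV \<and>
      uniform_limit (cball z d) (\<lambda>N x. \<Prod>n<N. 1 - x * p ^ n) (\<lambda>x. qPoch_inf x p) sequentially"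
    by (intro exI[of _ 1]) auto
qed auto

lemma mtheta_conv_qPoch_inf:
  assumes "norm p < 1"
  shows "mtheta x p = qPoch_inf x p * qPoch_inf (p / x) p"
  unfolding mtheta_def qPoch_inf_def
  using convergent_qPoch_inf[OF assms, of x] convergent_qPoch_inf[OF assms, of "p / x"]
  by (subst prodinf_mult) auto

text \<open>
  Splitting off the factor that vanishes at $1$ makes both functional equations of the theta
  function, and the simplicity of its zero at $1$, visible.
\<close>

lemma mtheta_factor:
  assumes "norm p < 1"
  shows "mtheta x p = (1 - x) * (qPoch_inf (p * x) p * qPoch_inf (p / x) p)"
  by (simp add: mtheta_conv_qPoch_inf[OF assms] qPoch_inf_step[OF assms, of x] mult_ac)

lemma mtheta_1: "norm p < 1 \<Longrightarrow> mtheta 1 p = 0"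
  by (simp add: mtheta_factor)

lemma mtheta_shift:
  assumes "0 < norm p" "norm p < 1" "x \<noteq> 0"
  shows "mtheta (p * x) p = - mtheta x p / x"
proof -
  have "mtheta (p * x) p = qPoch_inf (p * x) p * qPoch_inf (1 / x) p"
    using assms by (simp add: mtheta_conv_qPoch_inf)
  also have "qPoch_inf (1 / x) p = (1 - 1 / x) * qPoch_inf (p / x) p"
    using qPoch_inf_step[OF assms(2), of "1 / x"] by simp
  finally show ?thesis using assms by (simp add: mtheta_factor field_simps)
qed

lemma mtheta_inverse:
  assumes "0 < norm p" "norm p < 1" "x \<noteq> 0"
  shows "mtheta (1 / x) p = - mtheta x p / x"
  using assms by (simp add: mtheta_factor field_simps)

lemma mtheta_mult_minus:
  assumes "norm p < 1"
  shows "mtheta x p * mtheta (- x) p = mtheta (x\<^sup>2) (p\<^sup>2)"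
proof -
  have "norm (p\<^sup>2) < 1"
    using assms by (simp add: norm_power abs_square_less_1)
  hence "mtheta (x\<^sup>2) (p\<^sup>2) = qPoch_inf (x\<^sup>2) (p\<^sup>2) * qPoch_inf ((p / x)\<^sup>2) (p\<^sup>2)"
    by (simp add: mtheta_conv_qPoch_inf power_divide)
  also have "\<dots> = (qPoch_inf x p * qPoch_inf (- x) p) * (qPoch_inf (p / x) p * qPoch_inf (- (p / x)) p)"
    by (simp only: qPoch_inf_mult_minus[OF assms])
  finally show ?thesis by (simp add: mtheta_conv_qPoch_inf[OF assms] mult_ac)
qed

lemma mtheta_holomorphic [holomorphic_intros]:
  assumes "norm p < 1" "f holomorphic_on S" "\<And>x. x \<in> S \<Longrightarrow> f x \<noteq> 0"
  shows "(\<lambda>x. mtheta (f x) p) holomorphic_on S"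
proof -
  have *: "(\<lambda>x. qPoch_inf (h x) p) holomorphic_on S" if "h holomorphic_on S" for h
    using holomorphic_on_compose_gen[OF that qPoch_inf_holomorphic[OF assms(1)]] by (simp add: o_def)
  show ?thesis
    unfolding mtheta_conv_qPoch_inf[OF assms(1)]
    by (intro holomorphic_intros * assms)
qed

lemma mtheta_eq_0D:
  assumes "0 < norm p" "norm p < 1" "mtheta x p = 0" "x \<noteq> 0"
  obtains k :: int where "x = p powi k"
proof -
  have p: "p \<noteq> 0" using assms by auto
  consider "qPoch_inf x p = 0" | "qPoch_inf (p / x) p = 0"
    using assms by (auto simp: mtheta_conv_qPoch_inf)
  thus ?thesis
  proof cases
    case 1
    then obtain n where "x * p ^ n = 1" using qPoch_inf_eq_0D assms(2) by blast
    hence "x = p powi (- int n)" using p by (simp add: power_int_minus field_simps)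
    thus ?thesis by (rule that)
  next
    case 2
    then obtain n where "p / x * p ^ n = 1" using qPoch_inf_eq_0D assms(2) by blast
    hence "x = p ^ Suc n" using assms by (simp add: field_simps)
    hence "x = p powi (int (Suc n))" by (simp only: power_int_of_nat)
    thus ?thesis by (rule that)
  qed
qed

text \<open>
  The zeros are the powers of $p$, and only the zeroth power has modulus $1$. This point
  witnesses that theta functions of $ax$, $a/x$ or $-x^2$ do not vanish identically.
\<close>

lemma mtheta_minus_one_nonzero:
  assumes "0 < norm p" "norm p < 1"
  shows "mtheta (- 1) p \<noteq> 0"
proof
  assume "mtheta (- 1) p = 0"
  then obtain k :: int where k: "- 1 = p powi k"
    using mtheta_eq_0D[OF assms, of "- 1"] by auto
  hence "norm p powi k = 1" by (metis norm_minus_cancel norm_one norm_power_int)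
  hence "k = 0" using assms
    by (metis less_irrefl less_le_not_le power_int_strict_decreasing power_int_0_right linorder_neqE_linordered_idom)
  with k show False by simp
qed

section \<open>Division by a function with simple zeros\<close>

text \<open>
  At a simple zero of $F$ the quotient has the limit $f'(z)/F'(z)$ by l'Hopital's rule, so the
  singularity is removable.
\<close>

lemma holomorphic_div_simple_zeros:
  assumes S: "open S" and f: "f holomorphic_on S" and F: "F holomorphic_on S"
    and zero: "\<And>z. z \<in> S \<Longrightarrow> F z = 0 \<Longrightarrow> f z = 0"
    and simple: "\<And>z. z \<in> S \<Longrightarrow> F z = 0 \<Longrightarrow> deriv F z \<noteq> 0"
  obtains h where "h holomorphic_on S" "\<And>z. z \<in> S \<Longrightarrow> f z = F z * h z"
proof
  define h where "h = (\<lambda>z. if F z = 0 then deriv f z / deriv F z else f z / F z)"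
  show "f z = F z * h z" if "z \<in> S" for z
    using that zero by (simp add: h_def)
  have nz: "h holomorphic_on {z \<in> S. F z \<noteq> 0}"
  proof (rule holomorphic_transform)
    show "(\<lambda>z. f z / F z) holomorphic_on {z \<in> S. F z \<noteq> 0}"
      by (intro holomorphic_intros holomorphic_on_subset[OF f] holomorphic_on_subset[OF F]) auto
  qed (auto simp: h_def)
  have op: "open {z \<in> S. F z \<noteq> 0}"
    using continuous_open_preimage[OF holomorphic_on_imp_continuous_on[OF F] S, of "- {0}"]
    by (simp add: vimage_def Int_def open_Compl)
  have "h field_differentiable at z" if z: "z \<in> S" for z
  proof (cases "F z = 0")
    case False
    thus ?thesis using nz op z by (auto intro: holomorphic_on_imp_differentiable_at)
  next
    case True
    have dF: "(F has_field_derivative deriv F z) (at z)" and df: "(f has_field_derivative deriv f z) (at z)"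
      using f F S z by (auto intro: holomorphic_derivI)
    have "((\<lambda>w. f w / F w) \<longlongrightarrow> deriv f z / deriv F z) (at z)"
      by (rule lhopital_complex_simple[OF df dF]) (use True zero simple z in auto)
    moreover have ev: "\<forall>\<^sub>F w in at z. w \<in> S \<and> F w \<noteq> 0"
    proof -
      have "((\<lambda>w. (F w - F z) / (w - z)) \<longlongrightarrow> deriv F z) (at z)"
        using dF by (simp add: has_field_derivative_iff)
      hence "\<forall>\<^sub>F w in at z. (F w - F z) / (w - z) \<noteq> 0"
        using simple[OF z True] by (rule tendsto_imp_eventually_ne)
      thus ?thesis using eventually_at_in_open'[OF S z] by eventually_elim (auto simp: True)
    qed
    ultimately have lim: "(h \<longlongrightarrow> h z) (at z)"
      by (subst tendsto_cong[where g = "\<lambda>w. f w / F w"])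
         (auto simp: h_def True elim: eventually_mono)
    from ev obtain e where e: "e > 0" "\<And>w. w \<in> ball z e - {z} \<Longrightarrow> w \<in> S \<and> F w \<noteq> 0"
      unfolding eventually_at by (auto simp: dist_commute)
    have "h holomorphic_on ball z e"
    proof (rule no_isolated_singularity'[where K = "{z}"])
      show "h holomorphic_on ball z e - {z}"
        using e(2) by (intro holomorphic_on_subset[OF nz]) blast
      show "(h \<longlongrightarrow> h w) (at w within ball z e)" if "w \<in> {z}" for w
        using that lim by (auto intro: tendsto_within_subset)
    qed auto
    thus ?thesis using e(1) by (auto intro: holomorphic_on_imp_differentiable_at)
  qed
  thus "h holomorphic_on S"
    using S by (simp add: holomorphic_on_def field_differentiable_at_within)
qed

lemma connected_punctured_plane: "connected (- {0 :: complex})"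
  by (rule connected_punctured_universe) simp

text \<open>
  Used to transfer functional equations from $F h$ and $F$ to the quotient $h$: at the zeros
  of $F$ they hold by analytic continuation.
\<close>

lemma holomorphic_cancel_left:
  assumes S: "open S" "connected S" and hol: "F holomorphic_on S" "u holomorphic_on S" "v holomorphic_on S"
    and b: "b \<in> S" "F b \<noteq> 0"
    and eq: "\<And>z. z \<in> S \<Longrightarrow> F z * u z = F z * v z" and z: "z \<in> S"
  shows "u z = v z"
proof (rule analytic_continuation_open[where f = u and g = v and s = "{z \<in> S. F z \<noteq> 0}" and s' = S])
  show "open {z \<in> S. F z \<noteq> 0}"
    using continuous_open_preimage[OF holomorphic_on_imp_continuous_on[OF hol(1)] S(1), of "- {0}"]
    by (simp add: vimage_def Int_def open_Compl)
  show "u w = v w" if "w \<in> {z \<in> S. F z \<noteq> 0}" for w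
    using eq[of w] that by simp
  show "{z \<in> S. F z \<noteq> 0} \<noteq> {}" using b by blast
qed (use S hol z in auto)

text \<open>
  Simple zeros move along the functional equations of $F$: at a zero, the derivative of
  $a(x) F(b(x))$ has only the term in which $F$ is differentiated.
\<close>

lemma simple_zero_transfer:
  fixes F a b :: "complex \<Rightarrow> complex"
  assumes eq: "\<And>x. x \<noteq> 0 \<Longrightarrow> F x = a x * F (b x)" and z: "z \<noteq> 0"
    and F: "(F has_field_derivative D) (at (b z))" "F (b z) = 0" "D \<noteq> 0"
    and a: "a field_differentiable at z" "a z \<noteq> 0"
    and b: "(b has_field_derivative b') (at z)" "b' \<noteq> 0"
  shows "\<exists>D. D \<noteq> 0 \<and> (F has_field_derivative D) (at z)"
proof -
  from a obtain a' where a': "(a has_field_derivative a') (at z)"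
    by (auto simp: field_differentiable_def)
  have "((\<lambda>x. F (b x)) has_field_derivative D * b') (at z)"
    by (rule DERIV_chain2[OF F(1) b(1)])
  from DERIV_mult[OF a' this] F(2)
  have "((\<lambda>x. a x * F (b x)) has_field_derivative (a z * (D * b'))) (at z)"
    by (simp add: mult_ac)
  hence "(F has_field_derivative (a z * (D * b'))) (at z)"
    by (rule has_field_derivative_transform_within_open[where S = "- {0}"]) (use z eq[symmetric] in auto)
  thus ?thesis using a b F by (intro exI[of _ "a z * (D * b')"]) auto
qed

section \<open>Multiplicatively periodic holomorphic functions\<close>

text \<open>
  The annulus $|p| \leq |y| \leq 1$ contains a fundamental domain for $x \mapsto p x$.
\<close>

lemma powi_annulus:
  assumes "0 < norm p" "norm p < 1" "(x :: complex) \<noteq> 0"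
  obtains k :: int and y where "x = p powi k * y" "norm p \<le> norm y" "norm y \<le> 1"
proof
  \<comment> \<open>The modulus of $x$ is $|p|^t$; removing the integer part of $t$ leaves an exponent in $[0,1)$.\<close>
  define t where "t = ln (norm x) / ln (norm p)"
  define k where "k = floor t"
  have p: "p \<noteq> 0" using assms by auto
  show "x = p powi k * (x / p powi k)" using p by simp
  have lp: "ln (norm p) < 0" using assms by simp
  have "norm (x / p powi k) = norm x / norm p powi k"
    by (simp add: norm_divide norm_power_int)
  also have "\<dots> = norm p powr t / norm p powr (of_int k)"
    using assms lp by (simp add: powr_real_of_int'[symmetric] t_def powr_def)
  also have "\<dots> = norm p powr (t - k)" by (simp add: powr_diff)
  finally have *: "norm (x / p powi k) = norm p powr (t - k)" .
  have "0 \<le> t - k" "t - k \<le> 1" unfolding k_def by linarith+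
  thus "norm (x / p powi k) \<le> 1" "norm p \<le> norm (x / p powi k)"
    unfolding * using assms powr_mono'[of 0 "t - k" "norm p"] powr_mono'[of "t - k" 1 "norm p"] by auto
qed

lemma powi_orbit:
  assumes p: "p \<noteq> 0" and step: "\<And>z. z \<noteq> 0 \<Longrightarrow> S z \<longleftrightarrow> S (p * z)" and "S z" "(z :: complex) \<noteq> 0"
  shows "S (p powi k * z)"
proof (induction k rule: int_induct[where k = 0])
  case base
  show ?case using \<open>S z\<close> by simp
next
  case (step1 i)
  have "p powi (i + 1) * z = p * (p powi i * z)" using p by (simp add: power_int_add)
  with step1 step[of "p powi i * z"] p \<open>z \<noteq> 0\<close> show ?case by (simp add: mult.assoc)
next
  case (step2 i)
  have "p powi i * z = p * (p powi (i - 1) * z)" using p by (simp add: power_int_diff)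
  with step2 step[of "p powi (i - 1) * z"] p \<open>z \<noteq> 0\<close> show ?case by simp
qed

text \<open>
  The composition with the exponential function is entire, and it is bounded because it takes only
  values from a compact annulus.
\<close>

lemma periodic_holomorphic_constant:
  assumes p: "0 < norm p" "norm p < 1" and g: "g holomorphic_on - {0}"
    and per: "\<And>x. x \<noteq> 0 \<Longrightarrow> g (p * x) = g x"
  obtains C where "\<And>x. x \<noteq> 0 \<Longrightarrow> g x = C"
proof -
  have p0: "p \<noteq> 0" using p by auto
  define A :: "complex set" where "A = cball 0 1 - ball 0 (norm p)"
  have "compact (g ` A)"
  proof (rule compact_continuous_image)
    have "A \<subseteq> - {0}" using p by (auto simp: A_def)
    thus "continuous_on A g"
      using holomorphic_on_imp_continuous_on[OF g] continuous_on_subset by blast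
    show "compact A" unfolding A_def by (intro compact_diff) auto
  qed
  moreover have "range (g \<circ> exp) \<subseteq> g ` A"
  proof safe
    fix w :: complex
    obtain k :: int and y where y: "exp w = p powi k * y" "norm p \<le> norm y" "norm y \<le> 1"
      using powi_annulus[OF p, of "exp w"] by auto
    have "y \<noteq> 0" using y p by auto
    hence "g (p powi k * y) = g y"
      using powi_orbit[of p "\<lambda>x. g x = g y" y k] per p0 by simp
    moreover have "y \<in> A" using y by (auto simp: A_def)
    ultimately show "(g \<circ> exp) w \<in> g ` A" using y by simp
  qed
  ultimately have "bounded (range (g \<circ> exp))"
    by (meson bounded_subset compact_imp_bounded)
  moreover have "g \<circ> exp holomorphic_on UNIV"
    by (rule holomorphic_on_compose_gen[OF _ g]) (auto intro: holomorphic_intros)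
  ultimately have "(g \<circ> exp) constant_on UNIV" using Liouville_theorem by blast
  then obtain C where C: "\<And>w. g (exp w) = C" by (auto simp: constant_on_def)
  have "g x = C" if "x \<noteq> 0" for x using C[of "ln x"] that by simp
  thus ?thesis by (rule that)
qed

section \<open>The functions $P$ and $Q$\<close>

context
  fixes p :: complex
  assumes p: "0 < norm p" "norm p < 1"
begin

lemma base_nonzero: "p \<noteq> 0"
  using p by auto

lemma norm_base_square: "0 < norm (p\<^sup>2)" "norm (p\<^sup>2) < 1"
  using p by (auto simp: norm_power abs_square_less_1)

lemma qPoch_inf_minus_base_nonzero: "qPoch_inf (- p) p \<noteq> 0"
  by (rule qPoch_inf_nonzero) (use p in auto)

text \<open>
  As $P$ and $Q$ have the same multiplier $x^{-2}$ in the four laws below, all monomials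
  $P^k Q^{n-k}$ transform alike, and division by $x^n$ makes them numerators of index $n$.
\<close>

lemma Pfun_shift: "x \<noteq> 0 \<Longrightarrow> Pfun p (p * x) = Pfun p x / x\<^sup>2"
  using mtheta_shift[OF norm_base_square, of "- (x\<^sup>2)"]
  by (simp add: Pfun_def power_mult_distrib)

lemma Qfun_shift: "x \<noteq> 0 \<Longrightarrow> Qfun p (p * x) = Qfun p x / x\<^sup>2"
  using mtheta_shift[OF norm_base_square, of "- p * x\<^sup>2"] base_nonzero
  by (simp add: Qfun_def power_mult_distrib field_simps power2_eq_square)

lemma Pfun_inverse: "x \<noteq> 0 \<Longrightarrow> Pfun p (1 / x) = Pfun p x / x\<^sup>2"
  using mtheta_inverse[OF norm_base_square, of "- (x\<^sup>2)"]
  by (simp add: Pfun_def power_divide)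

lemma Qfun_inverse:
  assumes "x \<noteq> 0"
  shows "Qfun p (1 / x) = Qfun p x / x\<^sup>2"
proof -
  \<comment> \<open>Combining shift and inversion gives the symmetry $\theta(p^2/y;p^2) = \theta(y;p^2)$.\<close>
  have "mtheta (- p * (1 / x)\<^sup>2) (p\<^sup>2) = mtheta (p\<^sup>2 * (1 / (- p * x\<^sup>2))) (p\<^sup>2)"
    using base_nonzero assms by (simp add: field_simps power2_eq_square)
  also have "\<dots> = - mtheta (1 / (- p * x\<^sup>2)) (p\<^sup>2) / (1 / (- p * x\<^sup>2))"
    by (rule mtheta_shift[OF norm_base_square]) (use base_nonzero assms in auto)
  also have "mtheta (1 / (- p * x\<^sup>2)) (p\<^sup>2) = - mtheta (- p * x\<^sup>2) (p\<^sup>2) / (- p * x\<^sup>2)"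
    by (rule mtheta_inverse[OF norm_base_square]) (use base_nonzero assms in auto)
  finally have "mtheta (- p * (1 / x)\<^sup>2) (p\<^sup>2) = mtheta (- p * x\<^sup>2) (p\<^sup>2)"
    using base_nonzero assms by simp
  thus ?thesis
    using assms by (simp add: Qfun_def power2_eq_square)
qed

lemma Pfun_holomorphic: "Pfun p holomorphic_on - {0}"
  unfolding Pfun_def by (intro holomorphic_intros norm_base_square) auto

lemma Qfun_holomorphic: "Qfun p holomorphic_on - {0}"
  unfolding Qfun_def by (intro holomorphic_intros norm_base_square) (use base_nonzero in auto)

lemma mtheta_base_nonzero: "mtheta p (p\<^sup>2) \<noteq> 0"
proof -
  have "p\<^sup>2 / p = p" by (simp add: power2_eq_square)
  thus ?thesis
    using qPoch_inf_nonzero[of "p\<^sup>2" p] norm_base_square p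
    by (simp add: mtheta_conv_qPoch_inf)
qed

lemma Pfun_imaginary_unit: "Pfun p \<i> = 0"
  by (simp add: Pfun_def mtheta_1 norm_base_square)

lemma Qfun_imaginary_unit: "Qfun p \<i> = \<i> * (mtheta p (p\<^sup>2) * qPoch_inf (- p) p)"
  by (simp add: Qfun_def)

lemma Qfun_imaginary_unit_nonzero: "Qfun p \<i> \<noteq> 0"
  by (simp add: Qfun_imaginary_unit mtheta_base_nonzero qPoch_inf_minus_base_nonzero)

lemma Pfun_one_nonzero: "Pfun p 1 \<noteq> 0"
  using mtheta_minus_one_nonzero[OF norm_base_square] qPoch_inf_minus_base_nonzero
  by (simp add: Pfun_def)

text \<open>
  An induction principle for the zeros of $P$: they satisfy $x^2 = -p^{2k}$, so they are
  $\pm i p^k$, the orbit of $i$ under the two symmetries.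
\<close>

lemma Pfun_zero_orbit:
  assumes "Pfun p x = 0" "x \<noteq> 0"
    and "S \<i>"
    and inverse: "\<And>z. z \<noteq> 0 \<Longrightarrow> S (1 / z) \<Longrightarrow> S z"
    and shift: "\<And>z. z \<noteq> 0 \<Longrightarrow> S z \<longleftrightarrow> S (p * z)"
  shows "S x"
proof -
  have "mtheta (- (x\<^sup>2)) (p\<^sup>2) = 0"
    using assms(1) qPoch_inf_minus_base_nonzero by (simp add: Pfun_def)
  then obtain k :: int where k: "- (x\<^sup>2) = p\<^sup>2 powi k"
    using mtheta_eq_0D[OF norm_base_square] assms(2) by (metis neg_equal_0_iff_equal power_eq_0_iff)
  define y where "y = x / p powi k"
  have x: "x = p powi k * y" using base_nonzero by (simp add: y_def)
  have "p\<^sup>2 powi k = (p powi k)\<^sup>2"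
    by (simp add: power2_eq_square power_int_mult_distrib)
  hence "x\<^sup>2 = - ((p powi k)\<^sup>2)" using k by (metis minus_minus)
  hence "y\<^sup>2 = - 1"
    using base_nonzero by (simp add: y_def power_divide field_simps)
  hence "(y - \<i>) * (y + \<i>) = 0" by (simp add: algebra_simps power2_eq_square)
  hence "y = \<i> \<or> y = - \<i>" by (simp add: eq_neg_iff_add_eq_0)
  moreover have "S (- \<i>)" using inverse[of "- \<i>"] \<open>S \<i>\<close> by simp
  ultimately have "S y" "y \<noteq> 0" using \<open>S \<i>\<close> by auto
  thus "S x" unfolding x using powi_orbit[of p S y k] base_nonzero shift by blast
qed

text \<open>
  At $i$ the factor $1 + x^2$ of $P$ has a simple zero and the cofactor does not vanish; the
  functional equations carry this along the orbit.
\<close>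

lemma Pfun_zeros_simple:
  assumes "Pfun p x = 0" "x \<noteq> 0"
  shows "\<exists>D. D \<noteq> 0 \<and> (Pfun p has_field_derivative D) (at x)"
proof -
  define S where "S = (\<lambda>z. Pfun p z = 0 \<and> (\<exists>D. D \<noteq> 0 \<and> (Pfun p has_field_derivative D) (at z)))"
  have "S x"
  proof (rule Pfun_zero_orbit[OF assms, of S])
    \<comment> \<open>The cofactor of $1 + x^2$ in $P$.\<close>
    define R where "R = (\<lambda>x. qPoch_inf (p\<^sup>2 * - (x\<^sup>2)) (p\<^sup>2) * qPoch_inf (p\<^sup>2 / - (x\<^sup>2)) (p\<^sup>2) * qPoch_inf (- p) p)"
    have PR: "Pfun p x = (1 + x\<^sup>2) * R x" for x
      by (simp add: Pfun_def R_def mtheta_factor[OF norm_base_square(2)])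
    have "R \<i> \<noteq> 0"
      using qPoch_inf_nonzero[OF norm_base_square(2) norm_base_square(2)] qPoch_inf_minus_base_nonzero
      by (simp add: R_def)
    have "R holomorphic_on - {0}"
      unfolding R_def
      by (intro holomorphic_intros holomorphic_on_compose_gen[OF _ qPoch_inf_holomorphic[OF norm_base_square(2)],
            unfolded o_def]) auto
    then obtain R' where "(R has_field_derivative R') (at \<i>)"
      by (metis ComplI complex_i_not_zero field_differentiable_def holomorphic_on_imp_differentiable_at
          open_Compl closed_singleton singletonD)
    hence "((\<lambda>x. (1 + x\<^sup>2) * R x) has_field_derivative 2 * \<i> * R \<i>) (at \<i>)"
      by (auto intro!: derivative_eq_intros)
    hence "(Pfun p has_field_derivative 2 * \<i> * R \<i>) (at \<i>)"
      by (simp add: PR[abs_def])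
    thus "S \<i>" unfolding S_def using \<open>R \<i> \<noteq> 0\<close> Pfun_imaginary_unit by (intro conjI exI[of _ "2 * \<i> * R \<i>"]) auto
  next
    fix z :: complex assume z: "z \<noteq> 0" "S (1 / z)"
    then obtain D where D: "D \<noteq> 0" "(Pfun p has_field_derivative D) (at (1 / z))" "Pfun p (1 / z) = 0"
      by (auto simp: S_def)
    have "\<exists>D. D \<noteq> 0 \<and> (Pfun p has_field_derivative D) (at z)"
    proof (rule simple_zero_transfer[where D = D and a = "\<lambda>x. x\<^sup>2" and b = "\<lambda>x. 1 / x"])
      show "((\<lambda>x. 1 / x) has_field_derivative - 1 / z\<^sup>2) (at z)"
        using z by (auto intro!: derivative_eq_intros simp: power2_eq_square)
      show "(\<lambda>x. x\<^sup>2) field_differentiable at z" by (intro derivative_intros)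
    qed (use z D Pfun_inverse in auto)
    moreover have "Pfun p z = 0" using D(3) Pfun_inverse[of z] z by simp
    ultimately show "S z" by (simp add: S_def)
  next
    fix z :: complex assume z: "z \<noteq> 0"
    show "S z \<longleftrightarrow> S (p * z)"
    proof
      assume "S (p * z)"
      then obtain D where D: "D \<noteq> 0" "(Pfun p has_field_derivative D) (at (p * z))" "Pfun p (p * z) = 0"
        by (auto simp: S_def)
      have "\<exists>D. D \<noteq> 0 \<and> (Pfun p has_field_derivative D) (at z)"
      proof (rule simple_zero_transfer[where D = D and a = "\<lambda>x. x\<^sup>2" and b = "\<lambda>x. p * x"])
        show "((\<lambda>x. p * x) has_field_derivative p) (at z)"
          by (auto intro!: derivative_eq_intros)
        show "(\<lambda>x. x\<^sup>2) field_differentiable at z" by (intro derivative_intros)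
      qed (use z D Pfun_shift base_nonzero in auto)
      moreover have "Pfun p z = 0" using D(3) Pfun_shift[of z] z by simp
      ultimately show "S z" by (simp add: S_def)
    next
      assume "S z"
      then obtain D where D: "D \<noteq> 0" "(Pfun p has_field_derivative D) (at z)" "Pfun p z = 0"
        by (auto simp: S_def)
      have "\<exists>D. D \<noteq> 0 \<and> (Pfun p has_field_derivative D) (at (p * z))"
      proof (rule simple_zero_transfer[where D = D and a = "\<lambda>x. p\<^sup>2 / x\<^sup>2" and b = "\<lambda>x. x / p"])
        show "((\<lambda>x. x / p) has_field_derivative 1 / p) (at (p * z))"
          using base_nonzero by (auto intro!: derivative_eq_intros)
        show "(\<lambda>x. p\<^sup>2 / x\<^sup>2) field_differentiable at (p * z)"
          by (intro derivative_intros) (use z base_nonzero in auto)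
        show "Pfun p x = p\<^sup>2 / x\<^sup>2 * Pfun p (x / p)" if "x \<noteq> 0" for x
          using that base_nonzero Pfun_shift[of "x / p"] by (simp add: power_divide)
      qed (use z D base_nonzero in auto)
      moreover have "Pfun p (p * z) = 0" using D(3) Pfun_shift[of z] z by simp
      ultimately show "S (p * z)" by (simp add: S_def)
    qed
  qed
  thus ?thesis by (simp add: S_def)
qed

end

section \<open>Homogeneous forms in $P$ and $Q$\<close>

text \<open>
  The values at $0$ are left open, since only functions on the punctured plane matter.
\<close>

definition forms :: "complex \<Rightarrow> nat \<Rightarrow> (complex \<Rightarrow> complex) set" where
  "forms p n = {f. \<exists>lam. \<forall>x. x \<noteq> 0 \<longrightarrow> f x = (\<Sum>k\<le>n. lam k * Pfun p x ^ k * Qfun p x ^ (n - k))}"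

lemma formsI:
  "(\<And>x. x \<noteq> 0 \<Longrightarrow> f x = (\<Sum>k\<le>n. lam k * Pfun p x ^ k * Qfun p x ^ (n - k))) \<Longrightarrow> f \<in> forms p n"
  unfolding forms_def by blast

lemma forms_cong:
  assumes "f \<in> forms p n" "\<And>x. x \<noteq> 0 \<Longrightarrow> g x = f x"
  shows "g \<in> forms p n"
  using assms unfolding forms_def by auto

lemma forms_add:
  assumes "f \<in> forms p n" "g \<in> forms p n"
  shows "(\<lambda>x. f x + g x) \<in> forms p n"
proof -
  from assms obtain a b where
    "\<And>x. x \<noteq> 0 \<Longrightarrow> f x = (\<Sum>k\<le>n. a k * Pfun p x ^ k * Qfun p x ^ (n - k))"
    "\<And>x. x \<noteq> 0 \<Longrightarrow> g x = (\<Sum>k\<le>n. b k * Pfun p x ^ k * Qfun p x ^ (n - k))"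
    unfolding forms_def by blast
  thus ?thesis
    by (intro formsI[where lam = "\<lambda>k. a k + b k"]) (simp add: sum.distrib ring_distribs)
qed

lemma forms_scale:
  assumes "f \<in> forms p n"
  shows "(\<lambda>x. c * f x) \<in> forms p n"
proof -
  from assms obtain a where "\<And>x. x \<noteq> 0 \<Longrightarrow> f x = (\<Sum>k\<le>n. a k * Pfun p x ^ k * Qfun p x ^ (n - k))"
    unfolding forms_def by blast
  thus ?thesis
    by (intro formsI[where lam = "\<lambda>k. c * a k"]) (simp add: sum_distrib_left mult_ac)
qed

lemma forms_const: "(\<lambda>x. c) \<in> forms p 0"
  by (rule formsI[where lam = "\<lambda>_. c"]) simp

lemma forms_mult_Pfun:
  assumes "f \<in> forms p n"
  shows "(\<lambda>x. Pfun p x * f x) \<in> forms p (Suc n)"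
proof -
  from assms obtain a where a: "\<And>x. x \<noteq> 0 \<Longrightarrow> f x = (\<Sum>k\<le>n. a k * Pfun p x ^ k * Qfun p x ^ (n - k))"
    unfolding forms_def by blast
  show ?thesis
  proof (rule formsI[where lam = "\<lambda>k. case k of 0 \<Rightarrow> 0 | Suc j \<Rightarrow> a j"])
    fix x :: complex assume "x \<noteq> 0"
    thus "Pfun p x * f x =
      (\<Sum>k\<le>Suc n. (case k of 0 \<Rightarrow> 0 | Suc j \<Rightarrow> a j) * Pfun p x ^ k * Qfun p x ^ (Suc n - k))"
      by (subst sum.atMost_Suc_shift) (simp add: a sum_distrib_left mult_ac)
  qed
qed

lemma forms_mult_Qfun:
  assumes "f \<in> forms p n"
  shows "(\<lambda>x. Qfun p x * f x) \<in> forms p (Suc n)"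
proof -
  from assms obtain a where a: "\<And>x. x \<noteq> 0 \<Longrightarrow> f x = (\<Sum>k\<le>n. a k * Pfun p x ^ k * Qfun p x ^ (n - k))"
    unfolding forms_def by blast
  show ?thesis
  proof (rule formsI[where lam = "\<lambda>k. if k \<le> n then a k else 0"])
    fix x :: complex assume x: "x \<noteq> 0"
    have "(\<Sum>k\<le>Suc n. (if k \<le> n then a k else 0) * Pfun p x ^ k * Qfun p x ^ (Suc n - k)) =
          (\<Sum>k\<le>n. Qfun p x * (a k * Pfun p x ^ k * Qfun p x ^ (n - k)))"
      by (simp add: Suc_diff_le mult_ac)
    thus "Qfun p x * f x =
      (\<Sum>k\<le>Suc n. (if k \<le> n then a k else 0) * Pfun p x ^ k * Qfun p x ^ (Suc n - k))"
      by (simp add: a[OF x] sum_distrib_left)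
  qed
qed

lemma forms_Qfun_power: "(\<lambda>x. Qfun p x ^ n) \<in> forms p n"
proof (induction n)
  case 0 show ?case using forms_const[of 1] by simp
next
  case (Suc n) thus ?case using forms_mult_Qfun[OF Suc] by simp
qed

lemma forms_mult_linear:
  assumes "f \<in> forms p n"
  shows "(\<lambda>x. (a * Qfun p x - b * Pfun p x) * f x) \<in> forms p (Suc n)"
proof -
  have "(\<lambda>x. a * (Qfun p x * f x) + (- b) * (Pfun p x * f x)) \<in> forms p (Suc n)"
    by (intro forms_add forms_scale forms_mult_Pfun forms_mult_Qfun assms)
  thus ?thesis by (rule forms_cong) (simp add: algebra_simps)
qed

text \<open>
  In the application the linear factors are those that the addition formula supplies for the
  denominators that a generator does not have.
\<close>

lemma forms_mult_prod_linear:
  assumes "f \<in> forms p k"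
  shows "(\<lambda>x. f x * (\<Prod>j<d. a j * Qfun p x - b j * Pfun p x)) \<in> forms p (k + d)"
proof (induction d)
  case 0 show ?case using assms by simp
next
  case (Suc d)
  from forms_mult_linear[OF Suc, of "a d" "b d"] show ?case by (simp add: mult_ac)
qed

lemma numerators_holomorphic: "g \<in> numerators p n \<Longrightarrow> g holomorphic_on - {0}"
  unfolding numerators_def by blast

lemma numerators_inverse:
  assumes "g \<in> numerators p n" "x \<noteq> 0"
  shows "g (1 / x) = g x"
proof -
  have "\<forall>x. x \<noteq> 0 \<longrightarrow> g x = g (1 / x)" using assms(1) unfolding numerators_def by blast
  thus ?thesis using assms(2) by (blast intro: sym)
qed

lemma numerators_shift:
  "g \<in> numerators p n \<Longrightarrow> x \<noteq> 0 \<Longrightarrow> g (p * x) = 1 / (p ^ n * x ^ (2 * n)) * g x"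
  unfolding numerators_def by blast

context
  fixes p :: complex
  assumes p: "0 < norm p" "norm p < 1"
begin

text \<open>
  Induction on the index: after subtracting a multiple of $(Q(x)/x)^{n+1}$ the numerator vanishes
  at $i$, hence at all zeros of $P$, and division by $P(x)/x$ lowers the index by one.
\<close>

lemma numerators_subset_forms:
  assumes "g \<in> numerators p n"
  shows "(\<lambda>x. g x * x ^ n) \<in> forms p n"
  using assms
proof (induction n arbitrary: g)
  case 0
  hence "\<And>x. x \<noteq> 0 \<Longrightarrow> g (p * x) = g x" using numerators_shift[of g p 0] by simp
  then obtain C where "\<And>x. x \<noteq> 0 \<Longrightarrow> g x = C"
    using periodic_holomorphic_constant[OF p numerators_holomorphic[OF 0]] by blast
  thus ?case by (intro forms_cong[OF forms_const[of C]]) simp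
next
  case (Suc n)
  note p0 = base_nonzero[OF p]
  note g = numerators_holomorphic[OF Suc.prems] and g_inv = numerators_inverse[OF Suc.prems]
  have g_shift: "g (p * x) = 1 / (p * x\<^sup>2) ^ Suc n * g x" if "x \<noteq> 0" for x
    using numerators_shift[OF Suc.prems that] by (simp only: power_mult_distrib power_mult)
  \<comment> \<open>$F$ is the divisor; $l$ is chosen so that $f$ vanishes at $i$, which is possible as $Q(i) \neq 0$.\<close>
  define F where "F = (\<lambda>x. Pfun p x / x)"
  define l where "l = g \<i> / (Qfun p \<i> / \<i>) ^ Suc n"
  define f where "f = (\<lambda>x. g x - l * (Qfun p x / x) ^ Suc n)"
  have F_hol: "F holomorphic_on - {0}"
    unfolding F_def by (intro holomorphic_intros Pfun_holomorphic[OF p]) auto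
  have f_hol: "f holomorphic_on - {0}"
    unfolding f_def by (intro holomorphic_intros Qfun_holomorphic[OF p] g) auto
  have F_inv: "F (1 / x) = F x" if "x \<noteq> 0" for x
    using that Pfun_inverse[OF p] by (simp add: F_def power2_eq_square)
  have F_shift: "F (p * x) = 1 / (p * x\<^sup>2) * F x" if "x \<noteq> 0" for x
    using that Pfun_shift[OF p] by (simp add: F_def)
  have f_inv: "f (1 / x) = f x" if "x \<noteq> 0" for x
  proof -
    have "Qfun p (1 / x) / (1 / x) = Qfun p x / x"
      using that Qfun_inverse[OF p] by (simp add: power2_eq_square)
    thus ?thesis using that by (simp only: f_def g_inv[OF that])
  qed
  have f_shift: "f (p * x) = 1 / (p * x\<^sup>2) ^ Suc n * f x" if "x \<noteq> 0" for x
  proof -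
    have "Qfun p (p * x) / (p * x) = 1 / (p * x\<^sup>2) * (Qfun p x / x)"
      using that Qfun_shift[OF p] by simp
    hence "(Qfun p (p * x) / (p * x)) ^ Suc n = 1 / (p * x\<^sup>2) ^ Suc n * (Qfun p x / x) ^ Suc n"
      by (simp only: power_mult_distrib power_one_over)
    thus ?thesis using g_shift[OF that] by (simp only: f_def right_diff_distrib mult.left_commute)
  qed
  have "f \<i> = 0"
    using Qfun_imaginary_unit_nonzero[OF p] by (simp add: f_def l_def)
  have "f z = 0" if "z \<noteq> 0" "F z = 0" for z
  proof (rule Pfun_zero_orbit[OF p, of z])
    show "Pfun p z = 0" using that by (simp add: F_def)
    show "f w = 0 \<longleftrightarrow> f (p * w) = 0" if "w \<noteq> 0" for w
      using f_shift[OF that] that p0 by simp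
  qed (use that f_inv \<open>f \<i> = 0\<close> in auto)
  moreover have "deriv F z \<noteq> 0" if "z \<noteq> 0" "F z = 0" for z
  proof -
    have "Pfun p z = 0" using that by (simp add: F_def)
    with that(1) obtain D where D: "D \<noteq> 0" "(Pfun p has_field_derivative D) (at z)"
      using Pfun_zeros_simple[OF p] by blast
    have "(F has_field_derivative D / z) (at z)"
      unfolding F_def using that \<open>Pfun p z = 0\<close> by (auto intro!: derivative_eq_intros D(2))
    thus ?thesis using D(1) that by (simp add: DERIV_imp_deriv)
  qed
  ultimately obtain h where h: "h holomorphic_on - {0}" "\<And>z. z \<noteq> 0 \<Longrightarrow> f z = F z * h z"
    using holomorphic_div_simple_zeros[of "- {0}" f F] f_hol F_hol by (metis ComplD ComplI open_Compl closed_singleton singletonD singletonI)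
  have F1: "1 \<in> - {0 :: complex}" "F 1 \<noteq> 0" using Pfun_one_nonzero[OF p] by (auto simp: F_def)
  note cancel = holomorphic_cancel_left[OF _ connected_punctured_plane F_hol _ _ F1]
  \<comment> \<open>The quotient inherits the functional equations, with the factor for one index less.\<close>
  have "h \<in> numerators p n"
    unfolding numerators_def
  proof (intro CollectI conjI allI impI)
    fix x :: complex assume x: "x \<noteq> 0"
    show "h x = h (1 / x)"
    proof (rule cancel[of h "\<lambda>x. h (1 / x)"])
      show "(\<lambda>x. h (1 / x)) holomorphic_on - {0}"
        by (rule holomorphic_on_compose_gen[OF _ h(1), unfolded o_def]) (auto intro!: holomorphic_intros)
      show "F z * h z = F z * h (1 / z)" if "z \<in> - {0}" for z
        using that h(2)[of z] h(2)[of "1 / z"] F_inv[of z] f_inv[of z] by simp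
    qed (use x h in auto)
    have "p ^ n * x ^ (2 * n) * h (p * x) = h x"
    proof (rule cancel[of "\<lambda>x. p ^ n * x ^ (2 * n) * h (p * x)" h])
      show "(\<lambda>x. p ^ n * x ^ (2 * n) * h (p * x)) holomorphic_on - {0}"
        by (intro holomorphic_intros holomorphic_on_compose_gen[OF _ h(1), unfolded o_def]) (use p0 in auto)
      show "F z * (p ^ n * z ^ (2 * n) * h (p * z)) = F z * h z" if "z \<in> - {0}" for z
      proof -
        from that have z: "z \<noteq> 0" by simp
        have "1 / (p * z\<^sup>2) * F z * h (p * z) = 1 / (p * z\<^sup>2) ^ Suc n * (F z * h z)"
          using h(2)[of z] h(2)[of "p * z"] F_shift[OF z] f_shift[OF z] z p0 by simp
        hence "F z * ((p * z\<^sup>2) ^ n * h (p * z)) = F z * h z"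
          using z p0 by (simp add: field_simps)
        thus ?thesis by (simp add: power_mult_distrib power_mult)
      qed
    qed (use x h in auto)
    thus "h (p * x) = 1 / (p ^ n * x ^ (2 * n)) * h x"
      using x p0 by (simp add: field_simps)
  qed (rule h(1))
  hence "(\<lambda>x. Pfun p x * (h x * x ^ n) + l * Qfun p x ^ Suc n) \<in> forms p (Suc n)"
    by (intro forms_add forms_mult_Pfun forms_scale forms_Qfun_power Suc.IH)
  thus ?case
  proof (rule forms_cong)
    fix x :: complex assume x: "x \<noteq> 0"
    have "g x = F x * h x + l * (Qfun p x / x) ^ Suc n"
      using h(2)[OF x] unfolding f_def by (simp only: diff_eq_eq)
    hence "g x * x ^ Suc n = F x * h x * x ^ Suc n + l * ((Qfun p x / x) ^ Suc n * x ^ Suc n)"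
      by (simp only: distrib_right mult.assoc)
    thus "g x * x ^ Suc n = Pfun p x * (h x * x ^ n) + l * Qfun p x ^ Suc n"
      using x by (simp add: F_def power_divide)
  qed
qed

section \<open>The addition formula\<close>

text \<open>
  As a function of $x$ the right-hand side is $x$ times a numerator of index $1$, hence a linear
  combination of $P(x)$ and $Q(x)$. Its coefficients are found by evaluation at $x = i$, where $P$
  vanishes, and at a square root $w$ of $-p$, where $Q$ vanishes: there the two thetas become
  $\theta(y;p)$ and, up to a shift, $\theta(-y;p)$ for some $y$, with product $\theta(y^2;p^2)$.
  The constant is $((p;p^2)_\infty (-p;p)_\infty)^2$, which is $1$ by Euler's identity.
\<close>

lemma theta_addition:
  assumes a: "a \<noteq> 0" and x: "x \<noteq> 0"
  shows "Pfun p a * Qfun p x - Qfun p a * Pfun p x =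
    mtheta p (p\<^sup>2) * (qPoch_inf (- p) p)\<^sup>2 * (x * (mtheta (a * x) p * mtheta (a / x) p))"
proof -
  note p0 = base_nonzero[OF p]
  define K where "K = qPoch_inf (- p) p"
  define T where "T = mtheta p (p\<^sup>2)"
  define g where "g = (\<lambda>x. mtheta (a * x) p * mtheta (a / x) p)"
  have "g \<in> numerators p 1"
    unfolding numerators_def
  proof (intro CollectI conjI allI impI)
    show "g holomorphic_on - {0}"
      unfolding g_def by (intro holomorphic_intros p) (use a in auto)
    fix x :: complex assume x: "x \<noteq> 0"
    show "g x = g (1 / x)" by (simp add: g_def)
    have "mtheta (p * (a * x)) p = - mtheta (a * x) p / (a * x)"
      by (rule mtheta_shift[OF p]) (use a x in auto)
    hence 1: "mtheta (a * (p * x)) p = - mtheta (a * x) p / (a * x)"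
      by (simp only: mult.left_commute)
    have "mtheta (p * (a / (p * x))) p = - mtheta (a / (p * x)) p / (a / (p * x))"
      by (rule mtheta_shift[OF p]) (use a x p0 in auto)
    hence 2: "mtheta (a / (p * x)) p = - (a / (p * x)) * mtheta (a / x) p"
      using a x p0 by (simp add: field_simps)
    show "g (p * x) = 1 / (p ^ 1 * x ^ (2 * 1)) * g x"
      unfolding g_def 1 2 using a x p0 by (simp add: field_simps power2_eq_square)
  qed
  from numerators_subset_forms[OF this] obtain lam where
    "\<And>x. x \<noteq> 0 \<Longrightarrow> g x * x ^ 1 = (\<Sum>k\<le>1. lam k * Pfun p x ^ k * Qfun p x ^ (1 - k))"
    unfolding forms_def by blast
  hence lam: "\<And>x. x \<noteq> 0 \<Longrightarrow> x * g x = lam 0 * Qfun p x + lam 1 * Pfun p x"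
    by (simp add: mult_ac)
  have theta_neg: "mtheta (a * z) p * mtheta (- (a * z)) p = mtheta ((a * z)\<^sup>2) (p\<^sup>2)" for z
    by (rule mtheta_mult_minus[OF p(2)])
  have "\<i> * mtheta (- (a\<^sup>2)) (p\<^sup>2) = lam 0 * (\<i> * (T * K))"
    using lam[of \<i>] theta_neg[of \<i>]
    by (simp add: mult.commute[of \<i> a] g_def Qfun_imaginary_unit[OF p] Pfun_imaginary_unit[OF p] T_def K_def power_mult_distrib)
  hence 0: "Pfun p a = T * K\<^sup>2 * lam 0"
    by (simp add: Pfun_def K_def power2_eq_square)
  have 1: "Qfun p a = - (T * K\<^sup>2 * lam 1)"
  proof -
    define w where "w = csqrt (- p)"
    have w2: "w\<^sup>2 = - p" by (simp add: w_def)
    have w: "w \<noteq> 0" using w2 p0 by auto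
    have "mtheta (p\<^sup>2 * 1) (p\<^sup>2) = 0"
      using mtheta_shift[OF norm_base_square[OF p], of 1] mtheta_1[OF norm_base_square(2)[OF p]] by simp
    moreover have "- p * w\<^sup>2 = p\<^sup>2 * 1" unfolding w2 by (simp add: power2_eq_square)
    ultimately have "Qfun p w = 0" unfolding Qfun_def by simp
    moreover have "Pfun p w = T * K" by (simp add: Pfun_def w2 T_def K_def)
    moreover have "g w = a * w / p * mtheta (- (p * a\<^sup>2)) (p\<^sup>2)"
    proof -
      \<comment> \<open>As $w^2 = -p$, the second argument is the negative of the first, shifted by $1/p$.\<close>
      have aw: "a / w = - (a * w) / p"
        using w2 w p0 by (simp add: field_simps power2_eq_square)
      have "mtheta (p * (- (a * w) / p)) p = - mtheta (- (a * w) / p) p / (- (a * w) / p)"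
        by (rule mtheta_shift[OF p]) (use a w p0 in auto)
      hence "mtheta (- (a * w) / p) p = a * w / p * mtheta (- (a * w)) p"
        using a w p0 by (simp add: field_simps)
      hence "g w = a * w / p * (mtheta (a * w) p * mtheta (- (a * w)) p)"
        unfolding g_def aw by simp
      thus ?thesis unfolding theta_neg by (simp add: power_mult_distrib w2 mult_ac)
    qed
    ultimately have "w * (a * w / p * mtheta (- (p * a\<^sup>2)) (p\<^sup>2)) = lam 1 * (T * K)"
      using lam[OF w] by simp
    hence "w\<^sup>2 * a / p * mtheta (- (p * a\<^sup>2)) (p\<^sup>2) = lam 1 * (T * K)"
      by (simp add: power2_eq_square mult_ac)
    hence "- (a * mtheta (- (p * a\<^sup>2)) (p\<^sup>2)) = lam 1 * (T * K)"
      using p0 by (simp add: w2)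
    hence "a * mtheta (- (p * a\<^sup>2)) (p\<^sup>2) = - (lam 1 * (T * K))" by (metis minus_minus)
    hence "Qfun p a = - (lam 1 * (T * K)) * K" by (simp add: Qfun_def K_def)
    thus ?thesis by (simp add: power2_eq_square mult_ac)
  qed
  have "T * K\<^sup>2 * (x * g x) = Pfun p a * Qfun p x - Qfun p a * Pfun p x"
    unfolding 0 1 lam[OF x] by (simp add: algebra_simps)
  thus ?thesis by (simp add: T_def K_def g_def)
qed

lemma mtheta_mult_cosparse_nonzero:
  assumes "a \<noteq> 0"
  shows "\<forall>\<^sub>\<approx>x\<in>- {0}. mtheta (a * x) p * mtheta (a / x) p \<noteq> 0"
proof -
  have *: "\<forall>\<^sub>F x in at z. f x \<noteq> 0"
    if "f holomorphic_on - {0}" "z \<noteq> 0" "b \<noteq> 0" "f b \<noteq> 0" for f and z b :: complex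
    using non_zero_neighbour_alt[OF that(1) _ connected_punctured_plane, of z b] that
    by (auto simp: open_Compl elim: eventually_mono)
  note nz = mtheta_minus_one_nonzero[OF p]
  have "\<forall>\<^sub>F x in at z. mtheta (a * x) p \<noteq> 0" "\<forall>\<^sub>F x in at z. mtheta (a / x) p \<noteq> 0"
    if "z \<noteq> 0" for z
    by (rule *[OF _ that, of _ "- 1 / a"] *[OF _ that, of _ "- a"],
        use assms nz p in \<open>auto intro!: holomorphic_intros\<close>)+
  thus ?thesis
    by (auto simp: eventually_cosparse_open_eq open_Compl eventually_conj_iff)
qed

end

section \<open>Clearing denominators\<close>

lemma prod_lessThan_split:
  fixes f :: "nat \<Rightarrow> 'a :: comm_monoid_mult"
  assumes "m \<le> n"
  shows "(\<Prod>j<n. f j) = (\<Prod>j<m. f j) * (\<Prod>j<n - m. f (m + j))"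
proof -
  have "(\<Prod>j<m + d. f j) = (\<Prod>j<m. f j) * (\<Prod>j<d. f (m + j))" for d
    by (induction d) (simp_all add: mult.assoc)
  from this[of "n - m"] show ?thesis using assms by simp
qed

text \<open>
  The common denominator of all generators of $W_c^N$, up to a constant and a power of $x$, is
  a product of $N$ linear forms in $P$ and $Q$.
\<close>

lemma prod_theta_addition:
  assumes p: "0 < norm p" "norm p < 1" and "q \<noteq> 0" "c \<noteq> 0" "x \<noteq> 0"
  shows "(\<Prod>j<k. Pfun p (c * q ^ j) * Qfun p x - Qfun p (c * q ^ j) * Pfun p x) =
    (mtheta p (p\<^sup>2) * (qPoch_inf (- p) p)\<^sup>2) ^ k * x ^ k * theta_facts [c * x, c / x] q p k"
proof -
  have "Pfun p (c * q ^ j) * Qfun p x - Qfun p (c * q ^ j) * Pfun p x =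
    mtheta p (p\<^sup>2) * (qPoch_inf (- p) p)\<^sup>2 * x * (mtheta (c * x * q ^ j) p * mtheta (c / x * q ^ j) p)" for j
    using theta_addition[OF p, of "c * q ^ j" x] assms by (simp add: mult_ac)
  thus ?thesis
    by (simp add: theta_facts_def theta_fact_def prod.distrib power_mult_distrib mult_ac)
qed

lemma eventually_cosparse_nonzero: "\<forall>\<^sub>\<approx>x\<in>- {0 :: complex}. x \<noteq> 0"
  using eventually_in_cosparse[of "- {0 :: complex}" "- {0}"] by (simp add: open_Compl)

lemma theta_facts_cosparse_nonzero:
  assumes p: "0 < norm p" "norm p < 1" and "q \<noteq> 0" "c \<noteq> 0"
  shows "\<forall>\<^sub>\<approx>x\<in>- {0}. theta_facts [c * x, c / x] q p k \<noteq> 0"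
proof -
  have "\<forall>\<^sub>\<approx>x\<in>- {0}. \<forall>j\<in>{..<k}. mtheta (c * q ^ j * x) p * mtheta (c * q ^ j / x) p \<noteq> 0"
    by (rule eventually_ball_finite)
       (use mtheta_mult_cosparse_nonzero[OF p] assms in auto)
  thus ?thesis
    by eventually_elim (auto simp: theta_facts_def theta_fact_def mult_ac)
qed

text \<open>
  It suffices to treat a generator $g_k(x)/(cx,c/x;q,p)_k$: the first $k$ linear factors cancel its
  denominator, leaving a constant times $g_k(x) x^k$, a form of degree $k$, and the other $N - k$
  factors raise the degree to $N$.
\<close>

lemma Wspace_clear_denominators:
  assumes p: "0 < norm p" "norm p < 1" and q: "q \<noteq> 0" and c: "c \<noteq> 0"
    and "h \<in> Wspace p q c N"
  obtains f where "f \<in> forms p N"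
    "\<forall>\<^sub>\<approx>x\<in>- {0}. h x * (\<Prod>j<N. Pfun p (c * q ^ j) * Qfun p x - Qfun p (c * q ^ j) * Pfun p x) = f x"
proof -
  define E where "E = (\<lambda>j x. Pfun p (c * q ^ j) * Qfun p x - Qfun p (c * q ^ j) * Pfun p x)"
  define C where "C = mtheta p (p\<^sup>2) * (qPoch_inf (- p) p)\<^sup>2"
  define T where "T = (\<lambda>k x. theta_facts [c * x, c / x] q p k)"
  define V where "V = {h. \<exists>f\<in>forms p N. \<forall>\<^sub>\<approx>x\<in>- {0}. h x * (\<Prod>j<N. E j x) = f x}"
  have E: "(\<Prod>j<k. E j x) = C ^ k * x ^ k * T k x" if "x \<noteq> 0" for k x
    using prod_theta_addition[OF p q c that] by (simp add: E_def C_def T_def)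
  from assms obtain h0 where h0: "h0 \<in> cfun.span {\<lambda>x. g x / T k x |g k. k \<le> N \<and> g \<in> numerators p k}"
    and ev: "\<forall>\<^sub>\<approx>x\<in>- {0}. h x = h0 x"
    unfolding Wspace_def T_def by blast
  from h0 have "h0 \<in> V"
  proof (induction rule: cfun.span_induct_alt)
    case base
    have "(\<lambda>x. 0) \<in> forms p N" using forms_scale[OF forms_Qfun_power, of 0 p N] by simp
    thus ?case unfolding V_def by (intro CollectI bexI[of _ "\<lambda>x. 0"]) auto
  next
    case (step a u v)
    then obtain g k where u: "u = (\<lambda>x. g x / T k x)" and k: "k \<le> N" and g: "g \<in> numerators p k" by blast
    from step(2) obtain f where f: "f \<in> forms p N" "\<forall>\<^sub>\<approx>x\<in>- {0}. v x * (\<Prod>j<N. E j x) = f x"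
      by (auto simp: V_def)
    define f' where "f' = (\<lambda>x. a * (C ^ k * (g x * x ^ k * (\<Prod>j<N - k. E (k + j) x))))"
    have "(\<lambda>x. g x * x ^ k * (\<Prod>j<N - k. E (k + j) x)) \<in> forms p (k + (N - k))"
      unfolding E_def by (intro forms_mult_prod_linear numerators_subset_forms[OF p g])
    hence "f' \<in> forms p N"
      unfolding f'_def using k by (intro forms_scale) simp
    hence "(\<lambda>x. f' x + f x) \<in> forms p N" using f(1) by (rule forms_add)
    moreover have "\<forall>\<^sub>\<approx>x\<in>- {0}. ((\<lambda>x. a * u x) + v) x * (\<Prod>j<N. E j x) = f' x + f x"
      using f(2) theta_facts_cosparse_nonzero[OF p q c, of k] eventually_cosparse_nonzero
    proof eventually_elim
      case (elim x)
      hence "x \<noteq> 0" "T k x \<noteq> 0" by (auto simp: T_def)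
      define R where "R = (\<Prod>j<N - k. E (k + j) x)"
      have split: "(\<Prod>j<N. E j x) = C ^ k * x ^ k * T k x * R"
        unfolding R_def E[OF \<open>x \<noteq> 0\<close>, symmetric] by (rule prod_lessThan_split[OF k])
      have "u x * (\<Prod>j<N. E j x) = C ^ k * (g x * x ^ k * R)"
        unfolding split using \<open>T k x \<noteq> 0\<close> by (simp add: u)
      hence "(a * u x + v x) * (\<Prod>j<N. E j x) = f' x + f x"
        unfolding f'_def R_def by (simp only: distrib_right mult.assoc elim(1))
      thus ?case by simp
    qed
    ultimately show ?case by (auto simp: V_def)
  qed
  then obtain f where f: "f \<in> forms p N" "\<forall>\<^sub>\<approx>x\<in>- {0}. h0 x * (\<Prod>j<N. E j x) = f x"
    by (auto simp: V_def)
  from f(2) ev have "\<forall>\<^sub>\<approx>x\<in>- {0}. h x * (\<Prod>j<N. E j x) = f x"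
    by eventually_elim simp
  with f(1) show ?thesis using that unfolding E_def by blast
qed

theorem theorem1p14:
  fixes p q c :: complex and m N :: nat and g :: "complex \<Rightarrow> complex"
  assumes "0 < norm p" and "norm p < 1"
    and "q \<noteq> 0" and "c \<noteq> 0"
    and "m \<le> N"
    and "(\<lambda>x. g x / theta_facts [c * x, c / x] q p m) \<in> Wspace p q c N"
  shows "\<exists>lam :: nat \<Rightarrow> complex.
    (\<forall>\<^sub>\<approx>x\<in>- {0}. g x = 1 / x ^ m * (\<Sum>k\<le>N. lam k * Pfun p x ^ k * Qfun p x ^ (N - k)) *
        (\<Prod>k<N - m. 1 / (Pfun p (c * q ^ (m + k)) * Qfun p x
                        - Qfun p (c * q ^ (m + k)) * Pfun p x))) \<and>
    (m = N \<longrightarrow>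
      (\<forall>\<^sub>\<approx>x\<in>- {0}. g x = 1 / x ^ N * (\<Sum>k\<le>N. lam k * Pfun p x ^ k * Qfun p x ^ (N - k))))"
proof -
  note p = assms(1,2) and q = assms(3) and c = assms(4)
  define E where "E = (\<lambda>j x. Pfun p (c * q ^ j) * Qfun p x - Qfun p (c * q ^ j) * Pfun p x)"
  define C where "C = mtheta p (p\<^sup>2) * (qPoch_inf (- p) p)\<^sup>2"
  define T where "T = (\<lambda>k x. theta_facts [c * x, c / x] q p k)"
  have E: "(\<Prod>j<k. E j x) = C ^ k * x ^ k * T k x" if "x \<noteq> 0" for k x
    using prod_theta_addition[OF p q c that] by (simp add: E_def C_def T_def)
  have C: "C \<noteq> 0"
    using mtheta_base_nonzero[OF p] qPoch_inf_minus_base_nonzero[OF p] by (simp add: C_def)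
  obtain f where f: "f \<in> forms p N"
    and clear: "\<forall>\<^sub>\<approx>x\<in>- {0}. g x / T m x * (\<Prod>j<N. E j x) = f x"
    using Wspace_clear_denominators[OF p q c assms(6)] unfolding E_def T_def by blast
  \<comment> \<open>The first $m$ linear factors produce the constant $C^m$, which is absorbed into the coefficients.\<close>
  from forms_scale[OF f, of "1 / C ^ m"] obtain lam where
    lam: "\<And>x. x \<noteq> 0 \<Longrightarrow> 1 / C ^ m * f x = (\<Sum>k\<le>N. lam k * Pfun p x ^ k * Qfun p x ^ (N - k))"
    unfolding forms_def by blast
  have main: "\<forall>\<^sub>\<approx>x\<in>- {0}. g x = 1 / x ^ m * (\<Sum>k\<le>N. lam k * Pfun p x ^ k * Qfun p x ^ (N - k)) *
        (\<Prod>k<N - m. 1 / E (m + k) x)"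
    using clear theta_facts_cosparse_nonzero[OF p q c, of m] theta_facts_cosparse_nonzero[OF p q c, of N]
      eventually_cosparse_nonzero
  proof eventually_elim
    case (elim x)
    hence x: "x \<noteq> 0" "T m x \<noteq> 0" "T N x \<noteq> 0" by (auto simp: T_def)
    define R where "R = (\<Prod>k<N - m. E (m + k) x)"
    have split: "(\<Prod>j<N. E j x) = (\<Prod>j<m. E j x) * R"
      unfolding R_def using assms(5) by (rule prod_lessThan_split)
    have "R \<noteq> 0"
      using split E[OF x(1), of N] x C by auto
    have "f x = C ^ m * (g x * x ^ m * R)"
      using elim(1) x by (simp add: split E mult_ac)
    hence "(\<Sum>k\<le>N. lam k * Pfun p x ^ k * Qfun p x ^ (N - k)) = g x * x ^ m * R"
      using lam[OF x(1)] C by simp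
    moreover have "(\<Prod>k<N - m. 1 / E (m + k) x) = 1 / R"
      by (simp add: R_def prod_dividef)
    ultimately show ?case using x \<open>R \<noteq> 0\<close> by simp
  qed
  show ?thesis
  proof (intro exI[of _ lam] conjI impI)
    assume "m = N"
    with main show "\<forall>\<^sub>\<approx>x\<in>- {0}. g x = 1 / x ^ N * (\<Sum>k\<le>N. lam k * Pfun p x ^ k * Qfun p x ^ (N - k))"
      by simp
  qed (use main in \<open>simp add: E_def\<close>)
qed

end
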